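(* There is no squco graph of girth $6$. That is, there is no finite simple graph $G$ whose shortest cycle has length exactly $6$ and such that the square $G^2$ is isomorphic to the complement $\overline{G}$.
   Context: All graphs are finite and simple. The square $G^2$ of a graph $G$ has vertex set $V(G)$, and two distinct vertices are adjacent in $G^2$ if and only if their distance in $G$ is at most $2$. A graph $G$ is square-complementary (squco) if $G^2 \cong \overline{G}$, where $\overline{G}$ is the complement of $G$. The girth of $G$ is the length of a shortest cycle in $G$ ($\infty$ if $G$ is acyclic). *)

theory Defs
  imports "Graph_Theory.Graph_Theory" "HOL-Library.Extended_Nat"
begin

text \<open>
  A finite simple graph is a \<^locale>\<open>pair_graph\<close>: every edge \<open>uv\<close> is represented by the two arcs
  \<open>(u, v)\<close> and \<open>(v, u)\<close>.
\<close>

definition graph_dist :: "'a pair_pre_digraph \<Rightarrow> 'a \<Rightarrow> 'a \<Rightarrow> ereal" where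
  "graph_dist G u v = wf_digraph.\<mu> (with_proj G) (\<lambda>_. 1) u v"

definition graph_square :: "'a pair_pre_digraph \<Rightarrow> 'a pair_pre_digraph" where
  "graph_square G =
     \<lparr> pverts = pverts G,
       parcs = {(u, v). u \<in> pverts G \<and> v \<in> pverts G \<and> u \<noteq> v \<and> graph_dist G u v \<le> 2} \<rparr>"

definition graph_complement :: "'a pair_pre_digraph \<Rightarrow> 'a pair_pre_digraph" where
  "graph_complement G =
     \<lparr> pverts = pverts G,
       parcs = {(u, v). u \<in> pverts G \<and> v \<in> pverts G \<and> u \<noteq> v \<and> (u, v) \<notin> parcs G} \<rparr>"

definition squco :: "'a pair_pre_digraph \<Rightarrow> bool" where
  "squco G \<longleftrightarrow> digraph_iso (with_proj (graph_square G)) (with_proj (graph_complement G))"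

text \<open>
  In a symmetric digraph every edge gives a cycle of length 2 in the sense of
  \<^const>\<open>pre_digraph.cycle\<close>; the undirected cycles are those of length at least 3.
  The infimum of the empty set is \<open>\<infinity>\<close>.
\<close>
definition girth :: "'a pair_pre_digraph \<Rightarrow> enat" where
  "girth G = (INF p \<in> {p. pre_digraph.cycle (with_proj G) p \<and> 3 \<le> length p}. enat (length p))"

end

theory Submission
  imports Defs
begin

text \<open>
  Call two vertices far if their distance is at least 3. An isomorphism \<open>\<phi>\<close> from \<open>G\<^sup>2\<close> to the
  complement of \<open>G\<close> turns the far relation into adjacency, so the far graph also has no triangle
  and no 4-cycle, and the far-degree of \<open>x\<close> is the degree of \<open>\<phi> x\<close>. Hence, with \<open>\<delta>\<close> the minimum
  degree, some vertex \<open>v\<close> has only \<open>\<delta>\<close> far vertices. If \<open>\<delta> \<ge> 3\<close>, the tree of walks of length 3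
  starting with an edge \<open>vu\<close> already yields \<open>2(\<delta> - 1) > \<delta>\<close> vertices far from \<open>v\<close>. An isolated
  vertex and two opposite vertices of a hexagon would form a far triangle. A leaf forces the
  graph to consist of two far vertices \<open>u\<close>, \<open>e\<close> and their neighbourhoods, which the isomorphism
  does not allow. If \<open>\<delta> = 2\<close>, the graph is the tree of depth 2 below \<open>v\<close> plus two far
  vertices, and no such graph has all far-degrees at least 2 except the 7-cycle.
\<close>

section \<open>The far relation in a graph of girth at least 6\<close>

text \<open>A closed walk of length 3 or 5 contains an odd cycle, while one of length 4 may
  backtrack; hence the disjunction in \<open>no4\<close>. \<open>far_iff\<close> is the isomorphism
  condition with both sides negated. The 6-cycle itself enters separately, through
  \<open>hexagon\<close>.\<close>

locale girth_six_squco =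
  fixes V :: "'a set" and E :: "'a \<Rightarrow> 'a \<Rightarrow> bool" and \<phi> :: "'a \<Rightarrow> 'a"
  assumes fin: "finite V"
    and edge_V: "E x y \<Longrightarrow> x \<in> V"
    and sym: "E x y \<Longrightarrow> E y x"
    and irrefl: "\<not> E x x"
    and no3: "E a b \<Longrightarrow> E b c \<Longrightarrow> \<not> E c a"
    and no4: "E a b \<Longrightarrow> E b c \<Longrightarrow> E c d \<Longrightarrow> E d a \<Longrightarrow> a = c \<or> b = d"
    and no5: "E a b \<Longrightarrow> E b c \<Longrightarrow> E c d \<Longrightarrow> E d e \<Longrightarrow> \<not> E e a"
    and bij: "bij_betw \<phi> V V"
    and far_iff: "x \<in> V \<Longrightarrow> y \<in> V \<Longrightarrow>
      E (\<phi> x) (\<phi> y) \<longleftrightarrow> x \<noteq> y \<and> \<not> E x y \<and> (\<nexists>z. E x z \<and> E z y)"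
begin

definition far :: "'a \<Rightarrow> 'a \<Rightarrow> bool" where
  "far x y \<longleftrightarrow> x \<in> V \<and> y \<in> V \<and> x \<noteq> y \<and> \<not> E x y \<and> (\<nexists>z. E x z \<and> E z y)"

definition deg :: "'a \<Rightarrow> nat" where "deg x = card {y. E x y}"

definition far_deg :: "'a \<Rightarrow> nat" where "far_deg x = card {y. far x y}"

definition hexagon :: "'a \<Rightarrow> 'a \<Rightarrow> 'a \<Rightarrow> 'a \<Rightarrow> 'a \<Rightarrow> 'a \<Rightarrow> bool" where
  "hexagon a b c d e f \<longleftrightarrow>
     distinct [a, b, c, d, e, f] \<and> E a b \<and> E b c \<and> E c d \<and> E d e \<and> E e f \<and> E f a"

lemma edge_V2: "E x y \<Longrightarrow> y \<in> V"
  using edge_V sym by blast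

lemma finite_nbrs [simp]: "finite {y. E x y}"
  by (rule finite_subset[OF _ fin]) (auto intro: edge_V2)

lemma finite_far [simp]: "finite {y. far x y}"
  by (rule finite_subset[OF _ fin]) (auto simp: far_def)

lemma far_sym: "far x y \<Longrightarrow> far y x"
  using sym unfolding far_def by metis

lemma far_phi: "far x y \<longleftrightarrow> x \<in> V \<and> y \<in> V \<and> E (\<phi> x) (\<phi> y)"
  using far_iff unfolding far_def by blast

lemma phi_V: "x \<in> V \<Longrightarrow> \<phi> x \<in> V"
  using bij by (auto simp: bij_betw_def)

lemma phi_eq_iff: "x \<in> V \<Longrightarrow> y \<in> V \<Longrightarrow> \<phi> x = \<phi> y \<longleftrightarrow> x = y"
  using bij by (auto simp: bij_betw_def inj_on_def)

lemma deg_phi: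
  assumes "x \<in> V"
  shows "deg (\<phi> x) = far_deg x"
proof -
  have "{y. E (\<phi> x) y} = \<phi> ` {y. far x y}"
  proof (intro set_eqI iffI)
    fix y assume "y \<in> {y. E (\<phi> x) y}"
    moreover from this obtain z where "z \<in> V" "y = \<phi> z"
      using bij edge_V2 by (metis bij_betw_def imageE mem_Collect_eq)
    ultimately show "y \<in> \<phi> ` {y. far x y}"
      using assms by (auto simp: far_phi)
  qed (auto simp: far_phi)
  moreover have "inj_on \<phi> {y. far x y}"
    using bij by (auto simp: bij_betw_def inj_on_def far_def)
  ultimately show ?thesis
    by (simp add: deg_def far_deg_def card_image)
qed

lemma far_no_triangle: "far a x \<Longrightarrow> far a y \<Longrightarrow> \<not> far x y"
  using far_phi no3 far_sym by metis

lemma far_no_C4: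
  assumes "far a x" "far a y" "far b x" "far b y"
  shows "a = b \<or> x = y"
  using assms no4[of "\<phi> a" "\<phi> x" "\<phi> b" "\<phi> y"] phi_eq_iff far_sym far_phi by metis

text \<open>The form in which the absence of far triangles is mostly used: it produces an edge or a
  middle vertex.\<close>

lemma near_if_far_common:
  assumes "far a x" "far a y" "x \<noteq> y"
  shows "E x y \<or> (\<exists>z. E x z \<and> E z y)"
  using far_no_triangle[OF assms(1,2)] assms unfolding far_def by blast

lemma ex_other_nbr:
  assumes "2 \<le> deg x"
  shows "\<exists>y. E x y \<and> y \<noteq> a"
proof (rule ccontr)
  assume "\<not> ?thesis"
  then have "{y. E x y} \<subseteq> {a}" by blast
  then have "card {y. E x y} \<le> card {a}" by (intro card_mono) auto
  with assms show False by (simp add: deg_def)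
qed

lemma ex_other_far:
  assumes "2 \<le> far_deg x"
  shows "\<exists>y. far x y \<and> y \<noteq> a"
proof (rule ccontr)
  assume "\<not> ?thesis"
  then have "{y. far x y} \<subseteq> {a}" by blast
  then have "card {y. far x y} \<le> card {a}" by (intro card_mono) auto
  with assms show False by (simp add: far_deg_def)
qed

lemma deg_1_unique:
  assumes "deg x = 1" "E x y" "E x z"
  shows "y = z"
  using assms unfolding deg_def by (metis card_1_singletonE mem_Collect_eq singletonD)

lemma hexagon_rotate: "hexagon a b c d e f \<Longrightarrow> hexagon b c d e f a"
  unfolding hexagon_def by auto

text \<open>A shorter connection between opposite vertices would close a cycle of length 4 or 5 with
  half of the hexagon.\<close>

lemma hexagon_far:
  assumes "hexagon a b c d e f"
  shows "far a d"
proof -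
  have E: "E a b" "E b c" "E c d" "a \<noteq> c" "b \<noteq> d" "a \<noteq> d"
    using assms unfolding hexagon_def by auto
  have "\<not> E a d" using no4 E sym by blast
  moreover have "\<nexists>z. E a z \<and> E z d" using no5 E sym by blast
  ultimately show ?thesis
    using E edge_V edge_V2 unfolding far_def by blast
qed

section \<open>Minimum degree 0 or 1\<close>

lemma no_isolated:
  assumes "hexagon c0 c1 c2 c3 c4 c5" "w \<in> V"
  shows "deg w \<noteq> 0"
proof
  assume "deg w = 0"
  then have iso: "\<not> E w y" for y by (auto simp: deg_def)
  have "E c0 c1" "E c3 c4" using assms(1) unfolding hexagon_def by auto
  then have "far w c0" "far w c3"
    using iso assms(2) edge_V unfolding far_def by metis+
  then show False
    using far_no_triangle hexagon_far[OF assms(1)] by blast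
qed

lemma no_leaf_at_hexagon:
  assumes hex: "hexagon u c1 c2 e c4 c5" and leaf: "deg l = 1" "E l u"
  shows False
proof -
  have E: "E u c1" "E c1 c2" "E c2 e" "E e c4" "E c4 c5" "E c5 u"
    and dist: "distinct [u, c1, c2, e, c4, c5]"
    using hex unfolding hexagon_def by auto
  have l_far: "far l x" if "x \<in> V" "x \<noteq> l" "x \<noteq> u" "\<not> E u x" for x
    using that deg_1_unique[OF leaf(1)] leaf(2) edge_V unfolding far_def by metis
  have ue: "far u e" using hexagon_far[OF hex] .
  have not_l: "x \<noteq> l" if "E x y" "E x z" "y \<noteq> z" for x y z
    using that deg_1_unique[OF leaf(1)] by blast
  have ne: "c2 \<noteq> c4" "c1 \<noteq> e" "e \<noteq> c5" "c2 \<noteq> u" "c4 \<noteq> u" "e \<noteq> u"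
    using dist by auto
  have "e \<noteq> l" "c2 \<noteq> l" "c4 \<noteq> l"
    using not_l[of e c2 c4] not_l[of c2 c1 e] not_l[of c4 e c5] E ne sym by blast+
  moreover have "\<not> E u e" using ue by (simp add: far_def)
  moreover have "\<not> E u c2" "\<not> E u c4" using E no3 sym by blast+
  moreover have "e \<in> V" "c2 \<in> V" "c4 \<in> V" using E edge_V by blast+
  ultimately have le: "far l e" and "far l c2" and "far l c4"
    using l_far ne by blast+
  \<comment> \<open>Any other \<open>x\<close> is far from \<open>l\<close>, hence near
    \<open>e\<close>, \<open>c2\<close> and \<open>c4\<close>. Its path of length 2 to
    \<open>e\<close> leaves only edges to \<open>c2\<close> and \<open>c4\<close>, by
    \<open>no5\<close>, and these close a 4-cycle through \<open>e\<close>.\<close>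
  have V_cases: "x = u \<or> E u x \<or> x = e \<or> E e x" if "x \<in> V" for x
  proof (rule ccontr)
    assume *: "\<not> ?thesis"
    then have lx: "far l x" using l_far that leaf sym by metis
    have "x \<noteq> c2" "x \<noteq> c4" using * E sym by blast+
    obtain z where z: "E x z" "E z e"
      using near_if_far_common[OF lx le] * sym by blast
    have "E x c2"
      using near_if_far_common[OF lx \<open>far l c2\<close> \<open>x \<noteq> c2\<close>] no5 z E sym by metis
    moreover have "E x c4"
      using near_if_far_common[OF lx \<open>far l c4\<close> \<open>x \<noteq> c4\<close>] no5 z E sym by metis
    ultimately have "x = e" using no4[of x c2 e c4] E sym dist by auto
    with * show False by blast
  qed
  \<comment> \<open>Otherwise \<open>l\<close>, \<open>e\<close>, \<open>u\<close>, \<open>z\<close>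
    form a far 4-cycle.\<close>
  have e_nbr: "\<exists>y. E u y \<and> E y z" if "E e z" for z
  proof (rule ccontr)
    assume *: "\<not> ?thesis"
    have "z \<noteq> u" "\<not> E u z" using ue that sym unfolding far_def by metis+
    then have "far u z" using * ue that edge_V2 unfolding far_def by blast
    moreover have "far l z"
      using l_far[of z] that edge_V2 \<open>z \<noteq> u\<close> \<open>\<not> E u z\<close> leaf(2) sym by blast
    ultimately show False
      using far_no_C4[OF le _ ue] that irrefl leaf(2) by metis
  qed
  have far_u: "far u y \<longleftrightarrow> y = e" for y
    using V_cases[of y] e_nbr[of y] ue unfolding far_def by blast
  have uV: "u \<in> V" "e \<in> V" using ue by (auto simp: far_def)
  have dphi: "deg (\<phi> u) = 1"
    using deg_phi[OF uV(1)] by (simp add: far_deg_def far_u)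
  have not_phi: "x \<noteq> \<phi> u" if "E x y" "E x z" "y \<noteq> z" for x y z
    using that deg_1_unique[OF dphi] by blast
  have "u \<noteq> \<phi> u" using not_phi[of u c1 c5] E dist sym by auto
  moreover have "e \<noteq> \<phi> u" using not_phi[of e c2 c4] E dist sym by auto
  \<comment> \<open>A neighbour of \<open>e\<close> is also joined to a neighbour of
    \<open>u\<close>, so it has degree at least 2 and is not the leaf
    \<open>\<phi> u\<close>.\<close>
  moreover have "\<not> E e (\<phi> u)"
    using e_nbr not_phi ue sym unfolding far_def by metis
  ultimately have "E u (\<phi> u)" using V_cases phi_V uV by metis
  moreover have "E (\<phi> u) (\<phi> e)" using ue far_phi by blast
  txt \<open>Thus \<open>\<phi> u\<close> is a leaf attached to \<open>u\<close>, and its only neighbour is the image of the only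
    vertex far from \<open>u\<close>; comparing degrees gives the contradiction.\<close>
  ultimately have "\<phi> e = u" using deg_1_unique[OF dphi] sym by blast
  then have "deg u = far_deg e" using deg_phi uV by metis
  \<comment> \<open>\<open>c1\<close> and \<open>c5\<close> are removed because they reach
    \<open>e\<close> through \<open>c2\<close> and \<open>c4\<close>.\<close>
  also have "far_deg e \<le> card (insert u ({y. E u y} - {c1, c5}))"
    unfolding far_deg_def
  proof (rule card_mono)
    show "{y. far e y} \<subseteq> insert u ({y. E u y} - {c1, c5})"
      using V_cases E sym unfolding far_def by blast
  qed simp
  also have "\<dots> \<le> Suc (card ({y. E u y} - {c1, c5}))"
    by (rule card_insert_le_m1) auto
  also have "card ({y. E u y} - {c1, c5}) = deg u - 2"
    using E dist sym by (subst card_Diff_subset) (auto simp: deg_def)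
  finally have "deg u \<le> Suc (deg u - 2)" .
  \<comment> \<open>Now \<open>deg u\<close> is at least 2, so the subtraction is not truncated and
    the bound reads \<open>deg u \<le> deg u - 1\<close>.\<close>
  moreover have "card {c1, c5} \<le> deg u"
    unfolding deg_def using E sym by (intro card_mono) auto
  ultimately show False using dist by auto
qed

lemma no_leaf:
  assumes hex: "hexagon c0 c1 c2 c3 c4 c5"
  shows "deg l \<noteq> 1"
proof
  assume leaf: "deg l = 1"
  then obtain u where u: "E l u"
    by (auto simp: deg_def card_1_singleton_iff)
  note hexs = hex hex[THEN hexagon_rotate] hex[THEN hexagon_rotate, THEN hexagon_rotate]
  txt \<open>Everything outside the closed neighbourhood of \<open>u\<close> is far from \<open>l\<close>, so each of the three
    opposite pairs of the hexagon meets that neighbourhood; girth 6 then puts \<open>u\<close> on the hexagon.\<close>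
  have near: "a = u \<or> E u a \<or> d = u \<or> E u d" if h: "hexagon a b c d e f" for a b c d e f
  proof (rule ccontr)
    assume *: "\<not> ?thesis"
    have "a \<noteq> l" "d \<noteq> l"
      using h deg_1_unique[OF leaf] sym unfolding hexagon_def
      by (metis distinct_length_2_or_more)+
    then have "far l a" "far l d"
      using * deg_1_unique[OF leaf] u edge_V hexagon_far[OF h] unfolding far_def by metis+
    then show False using far_no_triangle hexagon_far[OF h] by blast
  qed
  have not_hex: "\<not> hexagon u b c d e f" for b c d e f
    using no_leaf_at_hexagon leaf u by blast
  then have ne: "u \<notin> {c0, c1, c2, c3, c4, c5}"
    using hex hexs(2,3) hexs(3)[THEN hexagon_rotate] hexs(3)[THEN hexagon_rotate, THEN hexagon_rotate]
      hexs(3)[THEN hexagon_rotate, THEN hexagon_rotate, THEN hexagon_rotate] by auto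
  have C: "E c0 c1" "E c1 c2" "E c2 c3" "E c3 c4" "E c4 c5" "E c5 c0"
    and dist: "distinct [c0, c1, c2, c3, c4, c5]"
    using hex unfolding hexagon_def by auto
  have n3: "\<not> (E u a \<and> E u b)" if "E a b" for a b
    using that no3 sym by blast
  have n4: "\<not> (E u a \<and> E u c)" if "E a b" "E b c" "a \<noteq> c" "b \<noteq> u" for a b c
    using that no4[of u a b c] sym by blast
  have "\<not> (E u c0 \<and> E u c1)" "\<not> (E u c1 \<and> E u c2)" "\<not> (E u c2 \<and> E u c3)"
    "\<not> (E u c3 \<and> E u c4)" "\<not> (E u c4 \<and> E u c5)" "\<not> (E u c5 \<and> E u c0)"
    using n3 C by blast+
  moreover have "\<not> (E u c0 \<and> E u c2)" "\<not> (E u c1 \<and> E u c3)" "\<not> (E u c2 \<and> E u c4)"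
    "\<not> (E u c3 \<and> E u c5)" "\<not> (E u c4 \<and> E u c0)" "\<not> (E u c5 \<and> E u c1)"
    using n4[OF C(1,2)] n4[OF C(2,3)] n4[OF C(3,4)] n4[OF C(4,5)] n4[OF C(5,6)] n4[OF C(6,1)]
      dist ne by auto
  \<comment> \<open>Vertices from different opposite pairs are one or two steps apart on the
    hexagon, which the preceding lines exclude for neighbours of \<open>u\<close>.\<close>
  moreover have "E u c0 \<or> E u c3" "E u c1 \<or> E u c4" "E u c2 \<or> E u c5"
    using near[OF hexs(1)] near[OF hexs(2)] near[OF hexs(3)] ne by blast+
  ultimately show False by blast
qed

section \<open>Minimum degree at least 3\<close>

lemma far_deg_lower:
  assumes d3: "3 \<le> k" and deg: "\<And>x. x \<in> V \<Longrightarrow> k \<le> deg x" and v: "v \<in> V"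
  shows "k < far_deg v"
proof -
  obtain u where u: "E v u"
    using ex_other_nbr[of v v] deg[OF v] d3 by auto
  have "\<exists>x y. E u x \<and> E u y \<and> x \<noteq> y \<and> x \<noteq> v \<and> y \<noteq> v"
  proof -
    have "2 \<le> card ({x. E u x} - {v})"
      using deg[of u] d3 u edge_V2 sym by (simp add: deg_def)
    then obtain S where "S \<subseteq> {x. E u x} - {v}" "card S = 2"
      by (meson obtain_subset_with_card_n)
    then show ?thesis by (auto simp: card_2_iff)
  qed
  then obtain x y where xy: "E u x" "E u y" "x \<noteq> y" "x \<noteq> v" "y \<noteq> v" by blast
  have far_v: "far v z" if "E u x" "x \<noteq> v" "E x z" "z \<noteq> u" for x z
  proof -
    have "v \<noteq> z" using that u no3 sym by blast
    moreover have "\<not> E v z" using that u no4[of v u x z] sym by blast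
    moreover have "\<nexists>w. E v w \<and> E w z" using that u no5 sym by metis
    ultimately show ?thesis using that v edge_V2 unfolding far_def by blast
  qed
  have c: "k - 1 \<le> card ({z. E x z} - {u})" if "E u x" for x
    using deg[of x] that edge_V2 sym by (simp add: deg_def)
  \<comment> \<open>A common element would close a 4-cycle with \<open>x\<close>, \<open>u\<close>,
    \<open>y\<close>.\<close>
  have "({z. E x z} - {u}) \<inter> ({z. E y z} - {u}) = {}"
    using xy no4[of u x _ y] sym by blast
  then have "card (({z. E x z} - {u}) \<union> ({z. E y z} - {u}))
      = card ({z. E x z} - {u}) + card ({z. E y z} - {u})"
    by (intro card_Un_disjoint) auto
  moreover have "card (({z. E x z} - {u}) \<union> ({z. E y z} - {u})) \<le> far_deg v"
    unfolding far_deg_def using far_v xy by (intro card_mono) auto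
  ultimately show ?thesis using c[OF xy(1)] c[OF xy(2)] d3 by linarith
qed

section \<open>Minimum degree 2\<close>

lemma not_far_deg_2:
  assumes hex: "hexagon c0 c1 c2 c3 c4 c5"
    and deg2: "\<And>x. x \<in> V \<Longrightarrow> 2 \<le> deg x"
    and fdeg2: "\<And>x. x \<in> V \<Longrightarrow> 2 \<le> far_deg x"
    and v: "v \<in> V"
  shows "far_deg v \<noteq> 2"
proof
  assume "far_deg v = 2"
  then obtain t t' where tt': "{y. far v y} = {t, t'}" "t \<noteq> t'"
    by (auto simp: far_deg_def card_2_iff)
  then have far_v: "far v y \<longleftrightarrow> y = t \<or> y = t'" for y by blast
  then have ft: "far v t" "far v t'" by auto
  \<comment> \<open>\<open>L u x\<close> places \<open>x\<close> at depth 2 of the tree rooted at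
    \<open>v\<close>, as a child of \<open>u\<close>.\<close>
  define L where "L u x \<longleftrightarrow> E v u \<and> E u x \<and> x \<noteq> v" for u x
  have L_E: "E v u" "E u x" "E u v" "E x u" "x \<noteq> v" if "L u x" for u x
    using that sym unfolding L_def by auto
  have V_cases: "x = v \<or> E v x \<or> (\<exists>u. L u x) \<or> x = t \<or> x = t'" if "x \<in> V" for x
    using that v far_v[of x] unfolding far_def L_def by blast
  \<comment> \<open>An edge between two vertices at depth 2 would close a walk of length 5 through
    \<open>v\<close>.\<close>
  have L_nbr: "y = u \<or> y = t \<or> y = t'" if "L u x" "E x y" for u x y
  proof -
    note * = L_E[OF that(1)]
    have "y \<noteq> v" using * that no3 by blast
    moreover have "E v y \<Longrightarrow> y = u" using * that no4[of v u x y] sym by blast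
    moreover have "\<not> L w y" for w using * that no5 L_E by metis
    ultimately show ?thesis using V_cases that edge_V2 by blast
  qed
  have L_t: "E x t \<or> E x t'" if "L u x" for u x
    using ex_other_nbr[OF deg2, of x u] L_nbr[OF that] that L_E edge_V by metis
  have L_ne: "x \<noteq> y" if "L i x" "L j y" "i \<noteq> j" for i j x y
    using L_E[OF that(1)] L_E[OF that(2)] that no4[of v i x j] by blast
  have L_same: "x = y" if "L i x" "L i y" "E x s" "E y s" "far v s" for i x y s
    using L_E[OF that(1)] L_E[OF that(2)] that no4[of i x s y] sym
    unfolding far_def by blast
  have far_L: "far a x" if "E v a" "L i x" "a \<noteq> i" for a i x
  proof -
    note * = L_E[OF that(2)]
    have "a \<noteq> x" using * that no3 sym by blast
    moreover have "\<not> E a x" using * that no4[of v a x i] sym by blast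
    moreover have "\<nexists>z. E a z \<and> E z x" using * that no5 sym by metis
    ultimately show ?thesis using that * edge_V edge_V2 unfolding far_def by blast
  qed
  txt \<open>The vertices far from \<open>a\<close> are pairwise at distance at most 2.\<close>
  have share: "E x t \<and> E y t \<or> E x t' \<and> E y t'"
    if h: "E v a" "L i x" "L j y" "a \<noteq> i" "a \<noteq> j" "i \<noteq> j" for a i j x y
  proof -
    have "\<not> E x y" using L_E[OF h(2)] L_E[OF h(3)] no5 by blast
    then obtain z where z: "E x z" "E z y"
      using near_if_far_common[OF far_L[OF h(1,2,4)] far_L[OF h(1,3,5)] L_ne[OF h(2,3,6)]]
      by blast
    have "z = i \<or> z = t \<or> z = t'" using L_nbr[OF h(2) z(1)] .
    moreover have "z = j \<or> z = t \<or> z = t'" using L_nbr[OF h(3) sym[OF z(2)]] .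
    ultimately show ?thesis using z sym h(6) by blast
  qed
  have t_nbr: "y = t \<or> y = t' \<or> (\<exists>u. L u y)" if "E s y" "far v s" for s y
    using V_cases[of y] that edge_V2 sym unfolding far_def by blast
  show False
  proof (cases "E t t'")
    case True
    obtain x where x: "E t x" "x \<noteq> t'" using ex_other_nbr[OF deg2] True edge_V by metis
    obtain y where y: "E t' y" "y \<noteq> t" using ex_other_nbr[OF deg2] True edge_V2 by metis
    obtain i where i: "L i x" using t_nbr[OF x(1) ft(1)] x irrefl by blast
    obtain j where j: "L j y" using t_nbr[OF y(1) ft(2)] y irrefl by blast
    have nx: "\<not> E x t'" and ny: "\<not> E y t" using no3 x y True sym by blast+
    have ij: "i \<noteq> j"
    proof
      assume "i = j"
      then have "E i x" "E x t" "E t t'" "E t' y" "E y i"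
        using L_E[OF i] L_E[OF j] x y True sym by auto
      then show False using no5 by blast
    qed
    \<comment> \<open>A third neighbour \<open>a\<close> of \<open>v\<close> would be far from
      \<open>x\<close> and \<open>y\<close>, so \<open>share\<close> would give them a common
      neighbour among \<open>t\<close> and \<open>t'\<close>.\<close>
    have two: "a = i \<or> a = j" if "E v a" for a
      using share[OF that i j] ij nx ny by blast
    \<comment> \<open>A second child of \<open>i\<close> would close a 5-cycle via \<open>t'\<close>
      or a 4-cycle via \<open>t\<close>.\<close>
    have Li: "z = x" if "L i z" for z
    proof -
      have "\<not> E z t'"
        using no5[of z t' t x i] L_E[OF i] L_E[OF that] x True sym by blast
      then have "E z t" using L_t[OF that] by blast
      then show ?thesis using L_same[OF that i] x sym ft by blast
    qed
    have Lj: "z = y" if "L j z" for z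
    proof -
      have "\<not> E z t"
        using no5[of z t t' y j] L_E[OF j] L_E[OF that] y True sym by blast
      then have "E z t'" using L_t[OF that] by blast
      then show ?thesis using L_same[OF that j] y sym ft by blast
    qed
    txt \<open>The graph would be a 7-cycle. Only one vertex lies off the hexagon, and far-degree at
      least 2 makes it far from both ends of an opposite pair.\<close>
    have "V \<subseteq> {v, i, j, x, y, t, t'}"
      using V_cases two Li Lj L_E(1) by blast
    then have "card V \<le> card {v, i, j, x, y, t, t'}" by (intro card_mono) auto
    also have "\<dots> \<le> 7"
      using card_length[of "[v, i, j, x, y, t, t']"] by simp
    finally have cV: "card V \<le> 7" .
    let ?C = "{c0, c1, c2, c3, c4, c5}"
    have C: "E c0 c1" "E c1 c2" "E c2 c3" "E c3 c4" "E c4 c5" "E c5 c0"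
      and dist: "distinct [c0, c1, c2, c3, c4, c5]"
      using hex unfolding hexagon_def by auto
    have CV: "?C \<subseteq> V" using C edge_V by blast
    have "card ?C = 6" using dist by simp
    then have "card (V - ?C) \<le> 1" using cV CV by (simp add: card_Diff_subset)
    then have uniq: "w = w'" if "w \<in> V - ?C" "w' \<in> V - ?C" for w w'
      using that card_le_Suc0_iff_eq[of "V - ?C"] fin by (metis One_nat_def finite_Diff)
    have c03: "far c0 c3" using hexagon_far[OF hex] .
    obtain w where w: "far c0 w" "w \<noteq> c3"
      using ex_other_far[OF fdeg2] c03 unfolding far_def by metis
    obtain w' where w': "far c3 w'" "w' \<noteq> c0"
      using ex_other_far[OF fdeg2] c03 unfolding far_def by metis
    have "w \<in> V - ?C" using w C sym unfolding far_def by blast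
    moreover have "w' \<in> V - ?C" using w' C sym unfolding far_def by blast
    ultimately have "w = w'" using uniq by blast
    then show False using far_no_triangle c03 w w' by blast
  next
    case False
    obtain w where w: "E t w" "E w t'"
      using near_if_far_common[OF ft tt'(2)] False by blast
    obtain a where a: "L a w" using t_nbr[OF w(1) ft(1)] w irrefl sym False by blast
    obtain x where x: "E t x" "x \<noteq> w" using ex_other_nbr[OF deg2] w edge_V by metis
    obtain y where y: "E t' y" "y \<noteq> w" using ex_other_nbr[OF deg2] w edge_V2 by metis
    have nx: "\<not> E x t'" using no4[of t w t' x] w x tt'(2) sym by blast
    have ny: "\<not> E y t" using no4[of t w t' y] w y tt'(2) sym by blast
    obtain i where i: "L i x" using t_nbr[OF x(1) ft(1)] x irrefl False by blast
    obtain j where j: "L j y" using t_nbr[OF y(1) ft(2)] y irrefl False sym by blast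
    have ia: "i \<noteq> a" using L_same[OF _ a _ _ ft(1)] i x w sym by blast
    have ja: "j \<noteq> a" using L_same[OF _ a _ _ ft(2)] j y w sym by blast
    \<comment> \<open>Both \<open>x\<close> and \<open>y\<close> are far from \<open>a\<close>;
      distinct parents would force a common neighbour \<open>t\<close> or \<open>t'\<close>.\<close>
    have ij: "i = j"
      using share[OF L_E(1)[OF a] i j] ia ja nx ny by metis
    \<comment> \<open>A child \<open>z\<close> of a third neighbour \<open>b\<close> must share
      \<open>t\<close> with \<open>x\<close> and \<open>t'\<close> with \<open>y\<close>; this makes
      it \<open>w\<close>, whose parent is \<open>a\<close>.\<close>
    have two: "b = a \<or> b = i" if b: "E v b" for b
    proof (rule ccontr)
      assume *: "\<not> ?thesis"
      obtain z where z: "E b z" "z \<noteq> v"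
        using ex_other_nbr[OF deg2] b edge_V2 by metis
      then have Lz: "L b z" using b unfolding L_def by blast
      have ne: "a \<noteq> b" "b \<noteq> i" "b \<noteq> j" using * ij by auto
      have "E z t"
        using share[OF L_E(1)[OF a] Lz i ne(1) ia[symmetric] ne(2)] nx by blast
      moreover have "E z t'"
        using share[OF L_E(1)[OF a] Lz j ne(1) ja[symmetric] ne(3)] ny by blast
      ultimately have "z = w" using no4[of t z t' w] w tt'(2) sym by blast
      then show False using L_ne[OF Lz a] * by blast
    qed
    have La: "z = w" if "L a z" for z
      using L_t[OF that] L_same[OF that a] w sym ft by blast
    \<comment> \<open>As \<open>i\<close> is the parent of both \<open>x\<close> and
      \<open>y\<close>, it reaches \<open>t\<close> and \<open>t'\<close> in two steps. Only
      \<open>w\<close> remains, so the far-degree of \<open>i\<close> is below 2.\<close>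
    have "z = w" if z: "far i z" for z
    proof -
      have "z \<noteq> v" "\<not> E v z" using z L_E[OF i] unfolding far_def by blast+
      moreover have "z \<noteq> t" "z \<noteq> t'"
        using z L_E[OF i] L_E[OF j] x y ij sym unfolding far_def by blast+
      moreover have "\<not> L i z" using z L_E unfolding far_def by blast
      ultimately show ?thesis
        using V_cases[of z] z two La L_E(1) unfolding far_def by blast
    qed
    then show False
      using ex_other_far[OF fdeg2, of i w] L_E[OF i] edge_V by blast
  qed
qed

section \<open>Case split on the minimum degree\<close>

lemma no_hexagon: "\<not> hexagon c0 c1 c2 c3 c4 c5"
proof
  assume hex: "hexagon c0 c1 c2 c3 c4 c5"
  then have "c0 \<in> V" using edge_V unfolding hexagon_def by blast
  then obtain w where w: "w \<in> V" "\<And>y. y \<in> V \<Longrightarrow> deg w \<le> deg y"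
    using ex_has_least_nat[of "\<lambda>x. x \<in> V" c0 deg] by blast
  obtain v where v: "v \<in> V" "\<phi> v = w"
    using bij w by (metis bij_betw_def imageE)
  have fv: "far_deg v = deg w" using deg_phi v by metis
  have fmin: "deg w \<le> far_deg x" if "x \<in> V" for x
    using deg_phi phi_V w that by metis
  consider "deg w = 0" | "deg w = 1" | "deg w = 2" | "3 \<le> deg w" by linarith
  then show False
  proof cases
    case 1 then show False using no_isolated[OF hex] w by blast
  next
    case 2 then show False using no_leaf[OF hex] by blast
  next
    case 3
    then show False using not_far_deg_2[OF hex _ _ v(1)] w fmin fv by metis
  next
    case 4
    then show False using far_deg_lower[of "deg w" v] w v fv by simp
  qed
qed

end

section \<open>From library digraphs to the adjacency relation\<close>

lemma (in pair_graph) graph_dist_le_2_iff: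
  assumes "u \<in> pverts G"
  shows "graph_dist G u v \<le> 2 \<longleftrightarrow>
    u = v \<or> (u, v) \<in> parcs G \<or> (\<exists>z. (u, z) \<in> parcs G \<and> (z, v) \<in> parcs G)"
    (is "_ \<longleftrightarrow> ?R")
proof -
  have cost: "awalk_cost (\<lambda>_. 1) p = real (length p)" for p :: "('a \<times> 'a) list"
    by (induct p) auto
  have short: "(\<exists>p. awalk u p v \<and> length p \<le> 2) \<longleftrightarrow> ?R"
  proof
    assume "\<exists>p. awalk u p v \<and> length p \<le> 2"
    then obtain p where p: "awalk u p v" "length p \<le> 2" by blast
    \<comment> \<open>\<open>remdups_adj.cases\<close> serves only to split lists into empty,
      singleton and longer ones.\<close>
    then consider "p = []" | a where "p = [a]" | a b where "p = [a, b]"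
      by (cases p rule: remdups_adj.cases) auto
    then show ?R
      using p(1) by cases (auto simp: awalk_def)
  next
    assume ?R
    then consider "awalk u [] v" | "awalk u [(u, v)] v" | z where "awalk u [(u, z), (z, v)] v"
      using assms by (auto simp: awalk_def)
    then show "\<exists>p. awalk u p v \<and> length p \<le> 2"
    proof cases
      case 1 then show ?thesis by (intro exI[of _ "[]"]) simp
    next
      case 2 then show ?thesis by (intro exI[of _ "[(u, v)]"]) simp
    next
      case (3 z) then show ?thesis by (intro exI[of _ "[(u, z), (z, v)]"]) simp
    qed
  qed
  have "graph_dist G u v \<le> 2 \<longleftrightarrow> (\<exists>p. awalk u p v \<and> length p \<le> 2)"
  proof
    assume "graph_dist G u v \<le> 2"
    \<comment> \<open>A strict bound on the infimum yields a walk below it, and integrality of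
      lengths turns \<open>< 3\<close> back into \<open>\<le> 2\<close>.\<close>
    also have "(2 :: ereal) < 3" by simp
    finally have "(INF p\<in>{p. awalk u p v}. ereal (awalk_cost (\<lambda>_. 1) p)) < 3"
      by (simp add: graph_dist_def \<mu>_def)
    then obtain p where "awalk u p v" "ereal (real (length p)) < 3"
      by (auto simp: INF_less_iff cost)
    then show "\<exists>p. awalk u p v \<and> length p \<le> 2"
      by (intro exI[of _ p]) (auto simp add: numeral_eq_ereal)
  next
    assume "\<exists>p. awalk u p v \<and> length p \<le> 2"
    then obtain p where p: "awalk u p v" "length p \<le> 2" by blast
    have "graph_dist G u v \<le> ereal (real (length p))"
      using min_cost_le_walk_cost[OF p(1), of "\<lambda>_. 1"] by (simp add: graph_dist_def cost)
    also have "\<dots> \<le> 2" using p(2) by (simp add: numeral_eq_ereal)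
    finally show "graph_dist G u v \<le> 2" .
  qed
  then show ?thesis using short by simp
qed

lemma (in pair_graph) girth_le_cycle:
  assumes "cycle p" "3 \<le> length p"
  shows "girth G \<le> enat (length p)"
  unfolding girth_def using assms by (intro INF_lower) auto

text \<open>Infima of nonempty sets are attained in the well-order \<open>enat\<close>; the empty
  set would give infinite girth.\<close>

lemma (in pair_graph) girth_attained:
  assumes "girth G \<noteq> \<infinity>"
  obtains p where "cycle p" "3 \<le> length p" "girth G = enat (length p)"
proof -
  let ?S = "(\<lambda>p. enat (length p)) ` {p. cycle p \<and> 3 \<le> length p}"
  have "?S \<noteq> {}"
  proof
    assume "?S = {}"
    then have "girth G = \<infinity>" by (metis Inf_enat_def girth_def)
    with assms show False by simp
  qed
  then obtain g where "g \<in> ?S" by blast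
  then have "Inf ?S \<in> ?S" by (rule wellorder_InfI)
  then show thesis using that unfolding girth_def by auto
qed

text \<open>A library isomorphism maps vertices and arcs separately. Comparing
  \<open>arcs_ends\<close> reduces it to one permutation of the vertices.\<close>

lemma squcoD:
  assumes "squco G"
  obtains \<phi> where "bij_betw \<phi> (pverts G) (pverts G)"
    "\<And>x y. x \<in> pverts G \<Longrightarrow> y \<in> pverts G \<Longrightarrow>
      (\<phi> x, \<phi> y) \<in> parcs (graph_complement G) \<longleftrightarrow> (x, y) \<in> parcs (graph_square G)"
proof -
  let ?S = "with_proj (graph_square G)"
  obtain f where f: "pre_digraph.digraph_isomorphism ?S f"
    and eq: "with_proj (graph_complement G) = app_iso f ?S"
    using assms unfolding squco_def digraph_iso_def by blast
  define \<phi> where "\<phi> = iso_verts f"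
  have pS: "pverts (graph_square G) = pverts G" "pverts (graph_complement G) = pverts G"
    by (simp_all add: graph_square_def graph_complement_def)
  have wf: "wf_digraph ?S"
    and inj: "inj_on \<phi> (pverts G)"
    using f pS by (auto simp: pre_digraph.digraph_isomorphism_def \<phi>_def)
  have "verts (with_proj (graph_complement G)) = verts (app_iso f ?S)"
    "arcs_ends (with_proj (graph_complement G)) = arcs_ends (app_iso f ?S)"
    using eq by auto
  then have img: "pverts G = \<phi> ` pverts G"
    and arcs: "parcs (graph_complement G) = (\<lambda>(u, v). (\<phi> u, \<phi> v)) ` parcs (graph_square G)"
    using wf_digraph.arcs_ends_app_iso_eq[OF wf f] pS
    by (auto simp: \<phi>_def)
  have sub: "parcs (graph_square G) \<subseteq> pverts G \<times> pverts G"
    by (auto simp: graph_square_def)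
  show thesis
  proof
    show "bij_betw \<phi> (pverts G) (pverts G)" using inj img by (simp add: bij_betw_def)
    show "(\<phi> x, \<phi> y) \<in> parcs (graph_complement G) \<longleftrightarrow> (x, y) \<in> parcs (graph_square G)"
      if "x \<in> pverts G" "y \<in> pverts G" for x y
    proof
      assume "(\<phi> x, \<phi> y) \<in> parcs (graph_complement G)"
      then obtain x' y' where "\<phi> x = \<phi> x'" "\<phi> y = \<phi> y'" "(x', y') \<in> parcs (graph_square G)"
        unfolding arcs by auto
      moreover from this(3) have "x' \<in> pverts G" "y' \<in> pverts G" using sub by auto
      ultimately show "(x, y) \<in> parcs (graph_square G)"
        using inj_onD[OF inj] that by metis
    qed (auto simp: arcs)
  qed
qed

theorem theorem3p1:
  shows "\<not> (\<exists>G :: 'a pair_pre_digraph. pair_graph G \<and> girth G = 6 \<and> squco G)"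
proof
  assume "\<exists>G :: 'a pair_pre_digraph. pair_graph G \<and> girth G = 6 \<and> squco G"
  then obtain G :: "'a pair_pre_digraph"
    where "pair_graph G" and girth: "girth G = 6" and squco: "squco G" by blast
  interpret pair_graph G by fact
  define E where "E x y \<longleftrightarrow> (x, y) \<in> parcs G" for x y
  have sym: "E y x" if "E x y" for x y
    using that arcs_symmetric by (simp add: E_def)
  have irrefl: "\<not> E x x" for x
    using no_loops' by (auto simp: E_def)
  have V: "x \<in> pverts G" if "E x y" for x y
    using that in_arcsD1 by (simp add: E_def)
  have six: "6 \<le> length p" if "cycle p" "3 \<le> length p" for p
    using girth_le_cycle[OF that] girth by (simp add: numeral_eq_enat)
  have no3: "\<not> E c a" if "E a b" "E b c" for a b c
  proof
    assume "E c a"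
    moreover from this that irrefl have "distinct [a, b, c]" by auto
    ultimately have "cycle [(a, b), (b, c), (c, a)]"
      using that V by (auto simp: cycle_def awalk_def E_def intro!: exI[of _ a])
    from six[OF this] show False by simp
  qed
  have no4: "a = c \<or> b = d" if "E a b" "E b c" "E c d" "E d a" for a b c d
  proof (rule ccontr)
    assume "\<not> ?thesis"
    then have "distinct [a, b, c, d]" using that irrefl by auto
    then have "cycle [(a, b), (b, c), (c, d), (d, a)]"
      using that V by (auto simp: cycle_def awalk_def E_def intro!: exI[of _ a])
    from six[OF this] show False by simp
  qed
  have no5: "\<not> E e a" if "E a b" "E b c" "E c d" "E d e" for a b c d e
  proof
    assume ea: "E e a"
    have "a \<noteq> b" "b \<noteq> c" "c \<noteq> d" "d \<noteq> e" "e \<noteq> a"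
      using that ea irrefl by auto
    \<comment> \<open>Identifying two non-consecutive vertices of the closed walk would leave a
      triangle.\<close>
    moreover have "a \<noteq> c" "b \<noteq> d" "c \<noteq> e" "d \<noteq> a" "e \<noteq> b"
      using that ea no3 by blast+
    ultimately have "distinct [a, b, c, d, e]" by auto
    then have "cycle [(a, b), (b, c), (c, d), (d, e), (e, a)]"
      using that ea V by (auto simp: cycle_def awalk_def E_def intro!: exI[of _ a])
    from six[OF this] show False by simp
  qed
  obtain \<phi> where bij: "bij_betw \<phi> (pverts G) (pverts G)"
    and iso: "\<And>x y. x \<in> pverts G \<Longrightarrow> y \<in> pverts G \<Longrightarrow>
      (\<phi> x, \<phi> y) \<in> parcs (graph_complement G) \<longleftrightarrow> (x, y) \<in> parcs (graph_square G)"
    using squcoD[OF squco] by blast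
  have far_iff: "E (\<phi> x) (\<phi> y) \<longleftrightarrow> x \<noteq> y \<and> \<not> E x y \<and> (\<nexists>z. E x z \<and> E z y)"
    if xy: "x \<in> pverts G" "y \<in> pverts G" for x y
  proof -
    have "\<phi> x \<in> pverts G" "\<phi> y \<in> pverts G" "\<phi> x = \<phi> y \<longleftrightarrow> x = y"
      using bij xy by (auto simp: bij_betw_def inj_on_def)
    then have "\<phi> x \<noteq> \<phi> y \<and> \<not> E (\<phi> x) (\<phi> y) \<longleftrightarrow> x \<noteq> y \<and> graph_dist G x y \<le> 2"
      using iso[OF xy] xy by (simp add: graph_complement_def graph_square_def E_def)
    then show ?thesis
      using graph_dist_le_2_iff[OF xy(1), of y] irrefl \<open>\<phi> x = \<phi> y \<longleftrightarrow> x = y\<close>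
      by (auto simp: E_def)
  qed
  interpret S: girth_six_squco "pverts G" E \<phi>
    by (rule girth_six_squco.intro;
        fact pair_finite_verts V sym irrefl no3 no4 no5 bij far_iff)
  obtain p where p: "cycle p" "length p = 6"
  proof (rule girth_attained)
    show "girth G \<noteq> \<infinity>" using girth by simp
  next
    fix p assume "cycle p" "girth G = enat (length p)"
    then show thesis using that girth by (simp add: numeral_eq_enat)
  qed
  \<comment> \<open>A cycle is a list of arcs; the tails of its six arcs are the hexagon.\<close>
  then obtain e0 e1 e2 e3 e4 e5 where "p = [e0, e1, e2, e3, e4, e5]"
    by (auto simp: length_Suc_conv numeral_eq_Suc)
  with p have "S.hexagon (fst e0) (fst e1) (fst e2) (fst e3) (fst e4) (fst e5)"
    by (cases e0; cases e1; cases e2; cases e3; cases e4; cases e5)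
      (auto simp: cycle_def awalk_def S.hexagon_def E_def)
  then show False using S.no_hexagon by blast
qed

end
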